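(* Let $K$ be a field, $\lambda\in K$, let $(A,\mu,\alpha_A,\beta_A,R_A)$ be a $\lambda$-Rota-Baxter BiHom-associative algebra and $(M,\triangleright,\triangleleft,\alpha_M,\beta_M,R_M)$ a $\lambda$-Rota-Baxter BiHom-bimodule on it. For $a,b\in A$, $m\in M$ define either (i) $a\succ m=R_A(a)\triangleright m$, $a\prec m=a\triangleright R_M(m)+\lambda a\triangleright m$, $m\succ a=R_M(m)\triangleleft a$, $m\prec a=m\triangleleft R_A(a)+\lambda m\triangleleft a$, together with $a\prec b=aR_A(b)+\lambda ab$, $a\succ b=R_A(a)b$ on $A$; or (ii) $a\succ m=R_A(a)\triangleright m+\lambda a\triangleright m$, $a\prec m=a\triangleright R_M(m)$, $m\succ a=R_M(m)\triangleleft a+\lambda m\triangleleft a$, $m\prec a=m\triangleleft R_A(a)$, together with $a\prec b=aR_A(b)$, $a\succ b=R_A(a)b+\lambda ab$ on $A$. Then, in case (i) and likewise in case (ii), $(M,\prec,\succ,\alpha_M,\beta_M)$ is a BiHom-dendriform bimodule over the BiHom-dendriform algebra $(A,\prec,\succ,\alpha_A,\beta_A)$.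
   Context: Everything is over the field $K$. BiHom-associative algebra $(A,\mu,\alpha,\beta)$: linear $\mu$ (written $ab$), $\alpha,\beta:A\to A$ with $\alpha\beta=\beta\alpha$, $\alpha,\beta$ multiplicative, $\alpha(a)(bc)=(ab)\beta(c)$. Bimodule $(M,\triangleright,\triangleleft,\alpha_M,\beta_M)$ over it: $\alpha_M\beta_M=\beta_M\alpha_M$; $f_M(a\triangleright m)=f_A(a)\triangleright f_M(m)$, $f_M(m\triangleleft a)=f_M(m)\triangleleft f_A(a)$ for $f\in\{\alpha,\beta\}$; $\alpha_A(a)\triangleright(a'\triangleright m)=(aa')\triangleright\beta_M(m)$; $\alpha_M(m)\triangleleft(aa')=(m\triangleleft a)\triangleleft\beta_A(a')$; $\alpha_A(a)\triangleright(m\triangleleft a')=(a\triangleright m)\triangleleft\beta_A(a')$. $\lambda$-Rota-Baxter BiHom-associative algebra $(A,\mu,\alpha,\beta,R)$: BiHom-associative algebra with linear $R$ commuting with $\alpha,\beta$ and $R(a)R(b)=R(aR(b))+R(R(a)b)+\lambda R(ab)$. $\lambda$-Rota-Baxter BiHom-bimodule $(M,\triangleright,\triangleleft,\alpha_M,\beta_M,R_M)$: a bimodule with linear $R_M$ commuting with $\alpha_M,\beta_M$ and $R_A(a)\triangleright R_M(m)=R_M(a\triangleright R_M(m)+R_A(a)\triangleright m+\lambda a\triangleright m)$, $R_M(m)\triangleleft R_A(a)=R_M(m\triangleleft R_A(a)+R_M(m)\triangleleft a+\lambda m\triangleleft a)$. BiHom-dendriform algebra $(A,\prec,\succ,\alpha,\beta)$: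 bilinear $\prec,\succ$ and linear commuting $\alpha,\beta$, both multiplicative for $\prec$ and $\succ$, with (D1) $(a\prec b)\prec\beta(c)=\alpha(a)\prec(b\prec c)+\alpha(a)\prec(b\succ c)$, (D2) $\alpha(a)\succ(b\prec c)=(a\succ b)\prec\beta(c)$, (D3) $\alpha(a)\succ(b\succ c)=(a\prec b)\succ\beta(c)+(a\succ b)\succ\beta(c)$. BiHom-dendriform bimodule $(M,\prec,\succ,\alpha_M,\beta_M)$ over it: a vector space $M$ with four bilinear operations $a\succ m,\ a\prec m,\ m\succ a,\ m\prec a\in M$ and commuting linear $\alpha_M,\beta_M$ such that $f_M(a\ast m)=f_A(a)\ast f_M(m)$, $f_M(m\ast a)=f_M(m)\ast f_A(a)$ for $f\in\{\alpha,\beta\}$, $\ast\in\{\prec,\succ\}$, and (D1), (D2), (D3) hold whenever exactly one of the three arguments lies in $M$ and the other two in $A$ (with $\alpha,\beta$ read as $\alpha_M,\beta_M$ on the argument in $M$ and as $\alpha_A,\beta_A$ otherwise). *)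

theory Defs
  imports Complex_Main
begin

definition vs_bilinear ::
  "('k::field \<Rightarrow> 'a::ab_group_add \<Rightarrow> 'a) \<Rightarrow> ('k \<Rightarrow> 'b::ab_group_add \<Rightarrow> 'b) \<Rightarrow>
   ('k \<Rightarrow> 'c::ab_group_add \<Rightarrow> 'c) \<Rightarrow> ('a \<Rightarrow> 'b \<Rightarrow> 'c) \<Rightarrow> bool"
  where "vs_bilinear s1 s2 s3 f \<longleftrightarrow>
    (\<forall>x. Vector_Spaces.linear s2 s3 (\<lambda>y. f x y)) \<and>
    (\<forall>y. Vector_Spaces.linear s1 s3 (\<lambda>x. f x y))"

locale bihom_associative_algebra =
  A: vector_space scaleA
  for scaleA :: "'k::field \<Rightarrow> 'a::ab_group_add \<Rightarrow> 'a" (infixr \<open>*\<^sub>A\<close> 75) +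
  fixes mul :: "'a \<Rightarrow> 'a \<Rightarrow> 'a" (infixl \<open>\<cdot>\<close> 70)
    and \<alpha>\<^sub>A \<beta>\<^sub>A :: "'a \<Rightarrow> 'a"
  assumes mul_bilinear: "vs_bilinear scaleA scaleA scaleA mul"
    and alphaA_linear: "Vector_Spaces.linear scaleA scaleA \<alpha>\<^sub>A"
    and betaA_linear: "Vector_Spaces.linear scaleA scaleA \<beta>\<^sub>A"
    and alphaA_betaA: "\<alpha>\<^sub>A (\<beta>\<^sub>A a) = \<beta>\<^sub>A (\<alpha>\<^sub>A a)"
    and alphaA_mul: "\<alpha>\<^sub>A (a \<cdot> b) = \<alpha>\<^sub>A a \<cdot> \<alpha>\<^sub>A b"
    and betaA_mul: "\<beta>\<^sub>A (a \<cdot> b) = \<beta>\<^sub>A a \<cdot> \<beta>\<^sub>A b"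
    and bihom_assoc: "\<alpha>\<^sub>A a \<cdot> (b \<cdot> c) = (a \<cdot> b) \<cdot> \<beta>\<^sub>A c"

locale bihom_bimodule =
  bihom_associative_algebra scaleA mul \<alpha>\<^sub>A \<beta>\<^sub>A + M: vector_space scaleM
  for scaleA :: "'k::field \<Rightarrow> 'a::ab_group_add \<Rightarrow> 'a" (infixr \<open>*\<^sub>A\<close> 75)
    and mul :: "'a \<Rightarrow> 'a \<Rightarrow> 'a" (infixl \<open>\<cdot>\<close> 70)
    and \<alpha>\<^sub>A \<beta>\<^sub>A :: "'a \<Rightarrow> 'a"
    and scaleM :: "'k \<Rightarrow> 'm::ab_group_add \<Rightarrow> 'm" (infixr \<open>*\<^sub>M\<close> 75) +
  fixes lact :: "'a \<Rightarrow> 'm \<Rightarrow> 'm" (infixr \<open>\<triangleright>\<close> 70)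
    and ract :: "'m \<Rightarrow> 'a \<Rightarrow> 'm" (infixl \<open>\<triangleleft>\<close> 70)
    and \<alpha>\<^sub>M \<beta>\<^sub>M :: "'m \<Rightarrow> 'm"
  assumes lact_bilinear: "vs_bilinear scaleA scaleM scaleM lact"
    and ract_bilinear: "vs_bilinear scaleM scaleA scaleM ract"
    and alphaM_linear: "Vector_Spaces.linear scaleM scaleM \<alpha>\<^sub>M"
    and betaM_linear: "Vector_Spaces.linear scaleM scaleM \<beta>\<^sub>M"
    and alphaM_betaM: "\<alpha>\<^sub>M (\<beta>\<^sub>M m) = \<beta>\<^sub>M (\<alpha>\<^sub>M m)"
    and alphaM_lact: "\<alpha>\<^sub>M (a \<triangleright> m) = \<alpha>\<^sub>A a \<triangleright> \<alpha>\<^sub>M m"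
    and betaM_lact: "\<beta>\<^sub>M (a \<triangleright> m) = \<beta>\<^sub>A a \<triangleright> \<beta>\<^sub>M m"
    and alphaM_ract: "\<alpha>\<^sub>M (m \<triangleleft> a) = \<alpha>\<^sub>M m \<triangleleft> \<alpha>\<^sub>A a"
    and betaM_ract: "\<beta>\<^sub>M (m \<triangleleft> a) = \<beta>\<^sub>M m \<triangleleft> \<beta>\<^sub>A a"
    and lact_lact: "\<alpha>\<^sub>A a \<triangleright> (a' \<triangleright> m) = (a \<cdot> a') \<triangleright> \<beta>\<^sub>M m"
    and ract_ract: "\<alpha>\<^sub>M m \<triangleleft> (a \<cdot> a') = (m \<triangleleft> a) \<triangleleft> \<beta>\<^sub>A a'"
    and lact_ract: "\<alpha>\<^sub>A a \<triangleright> (m \<triangleleft> a') = (a \<triangleright> m) \<triangleleft> \<beta>\<^sub>A a'"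

locale rota_baxter_bihom_associative_algebra =
  bihom_associative_algebra scaleA mul \<alpha>\<^sub>A \<beta>\<^sub>A
  for scaleA :: "'k::field \<Rightarrow> 'a::ab_group_add \<Rightarrow> 'a" (infixr \<open>*\<^sub>A\<close> 75)
    and mul :: "'a \<Rightarrow> 'a \<Rightarrow> 'a" (infixl \<open>\<cdot>\<close> 70)
    and \<alpha>\<^sub>A \<beta>\<^sub>A :: "'a \<Rightarrow> 'a" +
  fixes R\<^sub>A :: "'a \<Rightarrow> 'a" and l :: 'k
  assumes RA_linear: "Vector_Spaces.linear scaleA scaleA R\<^sub>A"
    and RA_alphaA: "R\<^sub>A (\<alpha>\<^sub>A a) = \<alpha>\<^sub>A (R\<^sub>A a)"
    and RA_betaA: "R\<^sub>A (\<beta>\<^sub>A a) = \<beta>\<^sub>A (R\<^sub>A a)"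
    and rota_baxter:
      "R\<^sub>A a \<cdot> R\<^sub>A b = R\<^sub>A (a \<cdot> R\<^sub>A b) + R\<^sub>A (R\<^sub>A a \<cdot> b) + l *\<^sub>A R\<^sub>A (a \<cdot> b)"

locale rota_baxter_bihom_bimodule =
  rota_baxter_bihom_associative_algebra scaleA mul \<alpha>\<^sub>A \<beta>\<^sub>A R\<^sub>A l +
  bihom_bimodule scaleA mul \<alpha>\<^sub>A \<beta>\<^sub>A scaleM lact ract \<alpha>\<^sub>M \<beta>\<^sub>M
  for scaleA :: "'k::field \<Rightarrow> 'a::ab_group_add \<Rightarrow> 'a" (infixr \<open>*\<^sub>A\<close> 75)
    and mul :: "'a \<Rightarrow> 'a \<Rightarrow> 'a" (infixl \<open>\<cdot>\<close> 70)
    and \<alpha>\<^sub>A \<beta>\<^sub>A R\<^sub>A :: "'a \<Rightarrow> 'a"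
    and l :: 'k
    and scaleM :: "'k \<Rightarrow> 'm::ab_group_add \<Rightarrow> 'm" (infixr \<open>*\<^sub>M\<close> 75)
    and lact :: "'a \<Rightarrow> 'm \<Rightarrow> 'm" (infixr \<open>\<triangleright>\<close> 70)
    and ract :: "'m \<Rightarrow> 'a \<Rightarrow> 'm" (infixl \<open>\<triangleleft>\<close> 70)
    and \<alpha>\<^sub>M \<beta>\<^sub>M :: "'m \<Rightarrow> 'm" +
  fixes R\<^sub>M :: "'m \<Rightarrow> 'm"
  assumes RM_linear: "Vector_Spaces.linear scaleM scaleM R\<^sub>M"
    and RM_alphaM: "R\<^sub>M (\<alpha>\<^sub>M m) = \<alpha>\<^sub>M (R\<^sub>M m)"
    and RM_betaM: "R\<^sub>M (\<beta>\<^sub>M m) = \<beta>\<^sub>M (R\<^sub>M m)"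
    and rota_baxter_lact:
      "R\<^sub>A a \<triangleright> R\<^sub>M m = R\<^sub>M (a \<triangleright> R\<^sub>M m + R\<^sub>A a \<triangleright> m + l *\<^sub>M (a \<triangleright> m))"
    and rota_baxter_ract:
      "R\<^sub>M m \<triangleleft> R\<^sub>A a = R\<^sub>M (m \<triangleleft> R\<^sub>A a + R\<^sub>M m \<triangleleft> a + l *\<^sub>M (m \<triangleleft> a))"

locale bihom_dendriform_algebra =
  A: vector_space scaleA
  for scaleA :: "'k::field \<Rightarrow> 'a::ab_group_add \<Rightarrow> 'a" (infixr \<open>*\<^sub>A\<close> 75) +
  fixes prec :: "'a \<Rightarrow> 'a \<Rightarrow> 'a" (infixl \<open>\<prec>\<close> 70)
    and succ :: "'a \<Rightarrow> 'a \<Rightarrow> 'a" (infixl \<open>\<succ>\<close> 70)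
    and \<alpha>\<^sub>A \<beta>\<^sub>A :: "'a \<Rightarrow> 'a"
  assumes prec_bilinear: "vs_bilinear scaleA scaleA scaleA prec"
    and succ_bilinear: "vs_bilinear scaleA scaleA scaleA succ"
    and alphaA_linear: "Vector_Spaces.linear scaleA scaleA \<alpha>\<^sub>A"
    and betaA_linear: "Vector_Spaces.linear scaleA scaleA \<beta>\<^sub>A"
    and alphaA_betaA: "\<alpha>\<^sub>A (\<beta>\<^sub>A a) = \<beta>\<^sub>A (\<alpha>\<^sub>A a)"
    and alphaA_prec: "\<alpha>\<^sub>A (a \<prec> b) = \<alpha>\<^sub>A a \<prec> \<alpha>\<^sub>A b"
    and alphaA_succ: "\<alpha>\<^sub>A (a \<succ> b) = \<alpha>\<^sub>A a \<succ> \<alpha>\<^sub>A b"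
    and betaA_prec: "\<beta>\<^sub>A (a \<prec> b) = \<beta>\<^sub>A a \<prec> \<beta>\<^sub>A b"
    and betaA_succ: "\<beta>\<^sub>A (a \<succ> b) = \<beta>\<^sub>A a \<succ> \<beta>\<^sub>A b"
    and D1: "(a \<prec> b) \<prec> \<beta>\<^sub>A c = \<alpha>\<^sub>A a \<prec> (b \<prec> c) + \<alpha>\<^sub>A a \<prec> (b \<succ> c)"
    and D2: "\<alpha>\<^sub>A a \<succ> (b \<prec> c) = (a \<succ> b) \<prec> \<beta>\<^sub>A c"
    and D3: "\<alpha>\<^sub>A a \<succ> (b \<succ> c) = (a \<prec> b) \<succ> \<beta>\<^sub>A c + (a \<succ> b) \<succ> \<beta>\<^sub>A c"

text \<open>
  The subscript of an action tells on which side the algebra element stands: the operations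
  \<open>\<prec>\<^sub>l\<close>, \<open>\<succ>\<^sub>l\<close> take it on the left and \<open>\<prec>\<^sub>r\<close>, \<open>\<succ>\<^sub>r\<close> on the right.
  In \<open>Di_j\<close> the \<open>j\<close>-th argument of axiom \<open>Di\<close> lies in the bimodule.
\<close>

locale bihom_dendriform_bimodule =
  bihom_dendriform_algebra scaleA prec succ \<alpha>\<^sub>A \<beta>\<^sub>A + M: vector_space scaleM
  for scaleA :: "'k::field \<Rightarrow> 'a::ab_group_add \<Rightarrow> 'a" (infixr \<open>*\<^sub>A\<close> 75)
    and prec :: "'a \<Rightarrow> 'a \<Rightarrow> 'a" (infixl \<open>\<prec>\<close> 70)
    and succ :: "'a \<Rightarrow> 'a \<Rightarrow> 'a" (infixl \<open>\<succ>\<close> 70)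
    and \<alpha>\<^sub>A \<beta>\<^sub>A :: "'a \<Rightarrow> 'a"
    and scaleM :: "'k \<Rightarrow> 'm::ab_group_add \<Rightarrow> 'm" (infixr \<open>*\<^sub>M\<close> 75) +
  fixes precl :: "'a \<Rightarrow> 'm \<Rightarrow> 'm" (infixl \<open>\<prec>\<^sub>l\<close> 70)
    and succl :: "'a \<Rightarrow> 'm \<Rightarrow> 'm" (infixl \<open>\<succ>\<^sub>l\<close> 70)
    and precr :: "'m \<Rightarrow> 'a \<Rightarrow> 'm" (infixl \<open>\<prec>\<^sub>r\<close> 70)
    and succr :: "'m \<Rightarrow> 'a \<Rightarrow> 'm" (infixl \<open>\<succ>\<^sub>r\<close> 70)
    and \<alpha>\<^sub>M \<beta>\<^sub>M :: "'m \<Rightarrow> 'm"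
  assumes precl_bilinear: "vs_bilinear scaleA scaleM scaleM precl"
    and succl_bilinear: "vs_bilinear scaleA scaleM scaleM succl"
    and precr_bilinear: "vs_bilinear scaleM scaleA scaleM precr"
    and succr_bilinear: "vs_bilinear scaleM scaleA scaleM succr"
    and alphaM_linear: "Vector_Spaces.linear scaleM scaleM \<alpha>\<^sub>M"
    and betaM_linear: "Vector_Spaces.linear scaleM scaleM \<beta>\<^sub>M"
    and alphaM_betaM: "\<alpha>\<^sub>M (\<beta>\<^sub>M m) = \<beta>\<^sub>M (\<alpha>\<^sub>M m)"
    and alphaM_precl: "\<alpha>\<^sub>M (a \<prec>\<^sub>l m) = \<alpha>\<^sub>A a \<prec>\<^sub>l \<alpha>\<^sub>M m"
    and alphaM_succl: "\<alpha>\<^sub>M (a \<succ>\<^sub>l m) = \<alpha>\<^sub>A a \<succ>\<^sub>l \<alpha>\<^sub>M m"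
    and alphaM_precr: "\<alpha>\<^sub>M (m \<prec>\<^sub>r a) = \<alpha>\<^sub>M m \<prec>\<^sub>r \<alpha>\<^sub>A a"
    and alphaM_succr: "\<alpha>\<^sub>M (m \<succ>\<^sub>r a) = \<alpha>\<^sub>M m \<succ>\<^sub>r \<alpha>\<^sub>A a"
    and betaM_precl: "\<beta>\<^sub>M (a \<prec>\<^sub>l m) = \<beta>\<^sub>A a \<prec>\<^sub>l \<beta>\<^sub>M m"
    and betaM_succl: "\<beta>\<^sub>M (a \<succ>\<^sub>l m) = \<beta>\<^sub>A a \<succ>\<^sub>l \<beta>\<^sub>M m"
    and betaM_precr: "\<beta>\<^sub>M (m \<prec>\<^sub>r a) = \<beta>\<^sub>M m \<prec>\<^sub>r \<beta>\<^sub>A a"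
    and betaM_succr: "\<beta>\<^sub>M (m \<succ>\<^sub>r a) = \<beta>\<^sub>M m \<succ>\<^sub>r \<beta>\<^sub>A a"
    and D1_1: "(m \<prec>\<^sub>r b) \<prec>\<^sub>r \<beta>\<^sub>A c = \<alpha>\<^sub>M m \<prec>\<^sub>r (b \<prec> c) + \<alpha>\<^sub>M m \<prec>\<^sub>r (b \<succ> c)"
    and D1_2: "(a \<prec>\<^sub>l m) \<prec>\<^sub>r \<beta>\<^sub>A c = \<alpha>\<^sub>A a \<prec>\<^sub>l (m \<prec>\<^sub>r c) + \<alpha>\<^sub>A a \<prec>\<^sub>l (m \<succ>\<^sub>r c)"
    and D1_3: "(a \<prec> b) \<prec>\<^sub>l \<beta>\<^sub>M m = \<alpha>\<^sub>A a \<prec>\<^sub>l (b \<prec>\<^sub>l m) + \<alpha>\<^sub>A a \<prec>\<^sub>l (b \<succ>\<^sub>l m)"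
    and D2_1: "\<alpha>\<^sub>M m \<succ>\<^sub>r (b \<prec> c) = (m \<succ>\<^sub>r b) \<prec>\<^sub>r \<beta>\<^sub>A c"
    and D2_2: "\<alpha>\<^sub>A a \<succ>\<^sub>l (m \<prec>\<^sub>r c) = (a \<succ>\<^sub>l m) \<prec>\<^sub>r \<beta>\<^sub>A c"
    and D2_3: "\<alpha>\<^sub>A a \<succ>\<^sub>l (b \<prec>\<^sub>l m) = (a \<succ> b) \<prec>\<^sub>l \<beta>\<^sub>M m"
    and D3_1: "\<alpha>\<^sub>M m \<succ>\<^sub>r (b \<succ> c) = (m \<prec>\<^sub>r b) \<succ>\<^sub>r \<beta>\<^sub>A c + (m \<succ>\<^sub>r b) \<succ>\<^sub>r \<beta>\<^sub>A c"
    and D3_2: "\<alpha>\<^sub>A a \<succ>\<^sub>l (m \<succ>\<^sub>r c) = (a \<prec>\<^sub>l m) \<succ>\<^sub>r \<beta>\<^sub>A c + (a \<succ>\<^sub>l m) \<succ>\<^sub>r \<beta>\<^sub>A c"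
    and D3_3: "\<alpha>\<^sub>A a \<succ>\<^sub>l (b \<succ>\<^sub>l m) = (a \<prec> b) \<succ>\<^sub>l \<beta>\<^sub>M m + (a \<succ> b) \<succ>\<^sub>l \<beta>\<^sub>M m"

end

theory Submission
  imports Defs
begin

text \<open>
  Each dendriform axiom moves its three arguments across one instance of BiHom-associativity.
  In (D1) this leaves a product of the images of two arguments under \<open>R\<close> (or \<open>R + \<lambda>\<close>) on the
  right, in (D3) on the left. The Rota-Baxter identity says that this product is the image of
  the sum of \<open>\<prec>\<close> and \<open>\<succ>\<close>; that sum is the same in both cases, and \<open>R + \<lambda>\<close> satisfies the same
  identity as \<open>R\<close>. Axiom (D2) needs associativity only.
\<close>

text \<open>\<open>Vector_Spaces.linear\<close> also asserts that domain and codomain are vector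
  spaces; assuming this leaves pure equations, usable both as goals and as rewrite rules.\<close>

lemma vs_bilinear_iff:
  assumes "vector_space s1" "vector_space s2" "vector_space s3"
  shows "vs_bilinear s1 s2 s3 f \<longleftrightarrow>
    (\<forall>x y z. f (x + y) z = f x z + f y z) \<and> (\<forall>x y z. f x (y + z) = f x y + f x z) \<and>
    (\<forall>c x y. f (s1 c x) y = s3 c (f x y)) \<and> (\<forall>c x y. f x (s2 c y) = s3 c (f x y))"
  using assms unfolding vs_bilinear_def Vector_Spaces.linear_iff by blast

context rota_baxter_bihom_bimodule
begin

lemmas bilinear_iffs =
  vs_bilinear_iff[OF A.vector_space_axioms A.vector_space_axioms A.vector_space_axioms]
  vs_bilinear_iff[OF A.vector_space_axioms M.vector_space_axioms M.vector_space_axioms]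
  vs_bilinear_iff[OF M.vector_space_axioms A.vector_space_axioms M.vector_space_axioms]

lemmas linearity_rules =
  mul_bilinear[unfolded bilinear_iffs, rule_format]
  lact_bilinear[unfolded bilinear_iffs, rule_format]
  ract_bilinear[unfolded bilinear_iffs, rule_format]
  alphaA_linear[unfolded Vector_Spaces.linear_iff]
  betaA_linear[unfolded Vector_Spaces.linear_iff]
  alphaM_linear[unfolded Vector_Spaces.linear_iff]
  betaM_linear[unfolded Vector_Spaces.linear_iff]
  RA_linear[unfolded Vector_Spaces.linear_iff]
  RM_linear[unfolded Vector_Spaces.linear_iff]
  A.scale_right_distrib M.scale_right_distrib

text \<open>The orientation matters: \<open>R (\<beta> c)\<close> becomes
  \<open>\<beta> (R c)\<close>, so the structure map ends up outermost, where BiHom-associativity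
  expects it.\<close>

lemmas structure_map_rules =
  alphaA_betaA alphaA_mul betaA_mul RA_alphaA RA_betaA
  alphaM_betaM alphaM_lact betaM_lact alphaM_ract betaM_ract RM_alphaM RM_betaM

text \<open>One law for three algebra elements and one for each position of a module element, all
  oriented alike, so a single choice of direction serves a dendriform axiom and its three module
  versions.\<close>

lemmas bihom_assoc_rules = bihom_assoc lact_lact ract_ract lact_ract

lemmas rota_baxter_rules = rota_baxter rota_baxter_lact rota_baxter_ract

lemma dendriform_bimodule_prec_weighted:
  "bihom_dendriform_bimodule
     scaleA (\<lambda>a b. a \<cdot> R\<^sub>A b + l *\<^sub>A (a \<cdot> b)) (\<lambda>a b. R\<^sub>A a \<cdot> b) \<alpha>\<^sub>A \<beta>\<^sub>A
     scaleM (\<lambda>a m. a \<triangleright> R\<^sub>M m + l *\<^sub>M (a \<triangleright> m)) (\<lambda>a m. R\<^sub>A a \<triangleright> m)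
            (\<lambda>m a. m \<triangleleft> R\<^sub>A a + l *\<^sub>M (m \<triangleleft> a)) (\<lambda>m a. R\<^sub>M m \<triangleleft> a) \<alpha>\<^sub>M \<beta>\<^sub>M"
  \<comment> \<open>Associativity is read from right to left for (D1) and from left to right for (D3), so that
    the two \<open>R\<close>-images become adjacent.\<close>
  by unfold_locales
    ((simp only: bilinear_iffs, simp add: linearity_rules ac_simps) |
     (rule alphaA_linear betaA_linear alphaM_linear betaM_linear) |
     (simp add: linearity_rules structure_map_rules rota_baxter_rules
        bihom_assoc_rules[symmetric] ac_simps; fail) |
     (simp add: linearity_rules structure_map_rules rota_baxter_rules
        bihom_assoc_rules ac_simps; fail))+

text \<open>Now (D3) multiplies images under \<open>R + l\<close>. With
  \<open>s = a R(b) + R(a) b + l a b\<close>, expanding gives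
  \<open>(R + l)(a) (R + l)(b) = R(a) R(b) + l s = R(s) + l s\<close>, so linearity and the identity
  for \<open>R\<close> suffice.\<close>

lemma dendriform_bimodule_succ_weighted:
  "bihom_dendriform_bimodule
     scaleA (\<lambda>a b. a \<cdot> R\<^sub>A b) (\<lambda>a b. R\<^sub>A a \<cdot> b + l *\<^sub>A (a \<cdot> b)) \<alpha>\<^sub>A \<beta>\<^sub>A
     scaleM (\<lambda>a m. a \<triangleright> R\<^sub>M m) (\<lambda>a m. R\<^sub>A a \<triangleright> m + l *\<^sub>M (a \<triangleright> m))
            (\<lambda>m a. m \<triangleleft> R\<^sub>A a) (\<lambda>m a. R\<^sub>M m \<triangleleft> a + l *\<^sub>M (m \<triangleleft> a)) \<alpha>\<^sub>M \<beta>\<^sub>M"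
  by unfold_locales
    ((simp only: bilinear_iffs, simp add: linearity_rules ac_simps) |
     (rule alphaA_linear betaA_linear alphaM_linear betaM_linear) |
     (simp add: linearity_rules structure_map_rules rota_baxter_rules
        bihom_assoc_rules[symmetric] ac_simps; fail) |
     (simp add: linearity_rules structure_map_rules rota_baxter_rules
        bihom_assoc_rules ac_simps; fail))+

end

theorem proposition2p33:
  fixes l :: "'k::field"
    and scaleA :: "'k \<Rightarrow> 'a::ab_group_add \<Rightarrow> 'a" (infixr \<open>*\<^sub>A\<close> 75)
    and mul :: "'a \<Rightarrow> 'a \<Rightarrow> 'a" (infixl \<open>\<cdot>\<close> 70)
    and \<alpha>\<^sub>A \<beta>\<^sub>A R\<^sub>A :: "'a \<Rightarrow> 'a"
    and scaleM :: "'k \<Rightarrow> 'm::ab_group_add \<Rightarrow> 'm" (infixr \<open>*\<^sub>M\<close> 75)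
    and lact :: "'a \<Rightarrow> 'm \<Rightarrow> 'm" (infixr \<open>\<triangleright>\<close> 70)
    and ract :: "'m \<Rightarrow> 'a \<Rightarrow> 'm" (infixl \<open>\<triangleleft>\<close> 70)
    and \<alpha>\<^sub>M \<beta>\<^sub>M R\<^sub>M :: "'m \<Rightarrow> 'm"
  assumes "rota_baxter_bihom_associative_algebra scaleA mul \<alpha>\<^sub>A \<beta>\<^sub>A R\<^sub>A l"
    and "rota_baxter_bihom_bimodule scaleA mul \<alpha>\<^sub>A \<beta>\<^sub>A R\<^sub>A l scaleM lact ract \<alpha>\<^sub>M \<beta>\<^sub>M R\<^sub>M"
  shows
    "bihom_dendriform_bimodule
       scaleA (\<lambda>a b. a \<cdot> R\<^sub>A b + l *\<^sub>A (a \<cdot> b)) (\<lambda>a b. R\<^sub>A a \<cdot> b) \<alpha>\<^sub>A \<beta>\<^sub>A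
       scaleM (\<lambda>a m. a \<triangleright> R\<^sub>M m + l *\<^sub>M (a \<triangleright> m)) (\<lambda>a m. R\<^sub>A a \<triangleright> m)
              (\<lambda>m a. m \<triangleleft> R\<^sub>A a + l *\<^sub>M (m \<triangleleft> a)) (\<lambda>m a. R\<^sub>M m \<triangleleft> a) \<alpha>\<^sub>M \<beta>\<^sub>M
     \<and>
     bihom_dendriform_bimodule
       scaleA (\<lambda>a b. a \<cdot> R\<^sub>A b) (\<lambda>a b. R\<^sub>A a \<cdot> b + l *\<^sub>A (a \<cdot> b)) \<alpha>\<^sub>A \<beta>\<^sub>A
       scaleM (\<lambda>a m. a \<triangleright> R\<^sub>M m) (\<lambda>a m. R\<^sub>A a \<triangleright> m + l *\<^sub>M (a \<triangleright> m))
              (\<lambda>m a. m \<triangleleft> R\<^sub>A a) (\<lambda>m a. R\<^sub>M m \<triangleleft> a + l *\<^sub>M (m \<triangleleft> a)) \<alpha>\<^sub>M \<beta>\<^sub>M"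
proof -
  interpret rota_baxter_bihom_bimodule scaleA mul \<alpha>\<^sub>A \<beta>\<^sub>A R\<^sub>A l scaleM lact ract \<alpha>\<^sub>M \<beta>\<^sub>M R\<^sub>M
    by fact
  show ?thesis
    using dendriform_bimodule_prec_weighted dendriform_bimodule_succ_weighted by blast
qed

end
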